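(* Let $\Gamma$ be a finitely generated recursively presented lawless group with decidable word problem, let $S$ be a finite generating set of $\Gamma$, and let $k\ge 2$ be a fixed integer. Then the lawlessness growth function $\mathcal{A}_{\Gamma}^S:\mathbb N\to\mathbb N$ (defined using words in $F_k$) is a computable function.
   Context: $\mathbb{N}=\{1,2,\dots\}$. Decidable word problem means there is an algorithm which, given a word in the free group $F(S)$, decides whether it represents the identity of $\Gamma$. For a group $\Gamma$ with finite generating set $S$, $|g|_S$ denotes the word length of $g\in\Gamma$ with respect to $S$ (letters from $S\cup S^{-1}$). $F_k$ is the free group on $x_1,\dots,x_k$ and $|w|$ is the reduced length of $w\in F_k$. For $w\in F_k$ and $\mathbf g=(g_1,\dots,g_k)\in\Gamma^k$, $w(\mathbf g)$ is the image of $w$ under the homomorphism $F_k\to\Gamma$, $x_i\mapsto g_i$. A law for $\Gamma$ is a nontrivial $w$ in some $F_k$ with $w(\mathbf g)=1$ for all $\mathbf g\in\Gamma^k$; $\Gamma$ is lawless if it has no laws. For $\Gamma$ lawless and $1\neq w\in F_k$, the complexity is $\chi_\Gamma^S(w)=\min\{\sum_{i=1}^k|g_i|_S : \mathbf g\in\Gamma^k,\ w(\mathbf g)\neq 1\}$, and the lawlessness growth function is $\mathcal A_\Gamma^S(n)=\max\{\chi_\Gamma^S(w) : 1\neq w\in F_k,\ |w|\le n\}$, where the rank $k\ge 2$ is fixed. *)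

theory Defs
  imports "HOL-Algebra.Generated_Groups" "HOL-Library.Nat_Bijection"
begin

section \<open>Computability\<close>

text \<open>
  Algorithms are Kleene's partial recursive functions. The result \<^term>\<open>None\<close> means that the
  computation diverges (or that the number of arguments does not fit).
\<close>

datatype recf =
    Zero
  | Succ
  | Proj nat
  | Comp recf "recf list"
  | PrimRec recf recf
  | Minim recf

fun rec_eval :: "recf \<Rightarrow> nat list \<Rightarrow> nat option" where
  "rec_eval Zero xs = Some 0"
| "rec_eval Succ xs = (case xs of [x] \<Rightarrow> Some (Suc x) | _ \<Rightarrow> None)"
| "rec_eval (Proj i) xs = (if i < length xs then Some (xs ! i) else None)"
| "rec_eval (Comp f gs) xs =
     (let ys = map (\<lambda>g. rec_eval g xs) gs in
      if None \<in> set ys then None else rec_eval f (map the ys))"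
| "rec_eval (PrimRec f g) xs =
     (case xs of
        [] \<Rightarrow> None
      | n # ys \<Rightarrow>
          rec_nat (rec_eval f ys)
            (\<lambda>m r. case r of None \<Rightarrow> None | Some z \<Rightarrow> rec_eval g (m # z # ys)) n)"
| "rec_eval (Minim f) xs =
     (if \<exists>n. rec_eval f (n # xs) = Some 0 \<and> (\<forall>m<n. \<exists>y. rec_eval f (m # xs) = Some (Suc y))
      then Some (LEAST n. rec_eval f (n # xs) = Some 0)
      else None)"

definition computable_on :: "nat set \<Rightarrow> (nat \<Rightarrow> nat) \<Rightarrow> bool" where
  "computable_on D f \<longleftrightarrow> (\<exists>p. \<forall>n\<in>D. rec_eval p [n] = Some (f n))"

definition recursively_enumerable :: "nat set \<Rightarrow> bool" where
  "recursively_enumerable A \<longleftrightarrow> (\<exists>p. \<forall>n. n \<in> A \<longleftrightarrow> rec_eval p [n] \<noteq> None)"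


section \<open>Free groups\<close>

text \<open>The letter \<^term>\<open>(x, True)\<close> stands for \<open>x\<close> and \<^term>\<open>(x, False)\<close> for its inverse.\<close>

type_synonym 'x word = "('x \<times> bool) list"

definition opposite :: "'x \<times> bool \<Rightarrow> 'x \<times> bool \<Rightarrow> bool" where
  "opposite a b \<longleftrightarrow> fst a = fst b \<and> snd a \<noteq> snd b"

definition reduced :: "'x word \<Rightarrow> bool" where
  "reduced w \<longleftrightarrow> successively (\<lambda>a b. \<not> opposite a b) w"

fun push :: "'x \<times> bool \<Rightarrow> 'x word \<Rightarrow> 'x word" where
  "push a [] = [a]"
| "push a (b # w) = (if opposite a b then w else a # b # w)"

text \<open>
  On reduced words, \<^term>\<open>foldr push u v\<close> is the free reduction of the concatenation \<open>u @ v\<close>.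
\<close>

definition free_group :: "'x set \<Rightarrow> 'x word monoid" where
  "free_group X =
     \<lparr>carrier = {w. set w \<subseteq> X \<times> UNIV \<and> reduced w}, mult = foldr push, one = []\<rparr>"

lemma push_props:
  assumes "w \<in> carrier (free_group X)" "a \<in> X \<times> UNIV"
  shows "push a w \<in> carrier (free_group X)"
  using assms
  by (cases w; cases "tl w") (auto simp: free_group_def reduced_def successively_Cons)

lemma foldr_push_closed:
  assumes "v \<in> carrier (free_group X)" "set u \<subseteq> X \<times> UNIV"
  shows "foldr push u v \<in> carrier (free_group X)"
  using assms(2) by (induction u) (use assms(1) push_props in auto)

lemma push_opposite:
  assumes "reduced w" "opposite a b"
  shows "push a (push b w) = w"
  using assms
  by (cases w; cases "tl w")
     (auto simp: reduced_def opposite_def successively_Cons prod_eq_iff)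

lemma reduced_foldr_push: "reduced v \<Longrightarrow> reduced (foldr push u v)"
  using foldr_push_closed[of v UNIV u] by (auto simp: free_group_def)

lemma foldr_push_push:
  assumes "reduced v"
  shows "foldr push (push a u) v = push a (foldr push u v)"
  using assms by (cases u) (auto simp: push_opposite reduced_foldr_push)

lemma foldr_push_assoc:
  assumes "reduced w"
  shows "foldr push (foldr push u v) w = foldr push u (foldr push v w)"
  by (induction u) (auto simp: foldr_push_push assms)

lemma foldr_push_Nil: "reduced w \<Longrightarrow> foldr push w [] = w"
proof (induction w)
  case (Cons a w)
  then have "foldr push w [] = w" by (auto simp: reduced_def successively_Cons)
  with Cons.prems show ?case by (cases w) (auto simp: reduced_def)
qed simp

lemma group_free_group: "group (free_group X)"
proof (rule groupI)
  fix w assume w: "w \<in> carrier (free_group X)"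
  define v where "v = rev (map (apsnd Not) w)"
  have red: "reduced v" "set v \<subseteq> X \<times> UNIV"
    using w unfolding v_def reduced_def free_group_def
    by (auto simp: successively_map opposite_def elim!: successively_mono)
  have "foldr push (rev (map (apsnd Not) u)) u = []" for u :: "'a word"
    by (induction u) (auto simp: opposite_def)
  then show "\<exists>v\<in>carrier (free_group X). v \<otimes>\<^bsub>free_group X\<^esub> w = \<one>\<^bsub>free_group X\<^esub>"
    using red by (intro bexI[of _ v]) (auto simp: free_group_def v_def)
next
  fix u v assume "u \<in> carrier (free_group X)" "v \<in> carrier (free_group X)"
  then show "u \<otimes>\<^bsub>free_group X\<^esub> v \<in> carrier (free_group X)"
    using foldr_push_closed[of v X u] by (simp add: free_group_def)
next
  show "\<one>\<^bsub>free_group X\<^esub> \<in> carrier (free_group X)"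
    by (simp add: free_group_def reduced_def)
qed (auto simp: free_group_def foldr_push_assoc)

definition word_eval :: "('g, 'b) monoid_scheme \<Rightarrow> ('x \<Rightarrow> 'g) \<Rightarrow> 'x word \<Rightarrow> 'g" where
  "word_eval G g w =
     foldr (\<lambda>(x, b) y. (if b then g x else inv\<^bsub>G\<^esub> (g x)) \<otimes>\<^bsub>G\<^esub> y) w \<one>\<^bsub>G\<^esub>"

lemma word_eval_closed:
  assumes "group G" "g \<in> X \<rightarrow> carrier G" "set w \<subseteq> X \<times> UNIV"
  shows "word_eval G g w \<in> carrier G"
  using assms(3)
proof (induction w)
  case Nil
  then show ?case using assms(1) by (simp add: word_eval_def group.is_monoid)
next
  case (Cons a w)
  interpret group G by (fact assms(1))
  show ?case using Cons assms(2) by (cases a) (auto simp: word_eval_def)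
qed

lemma word_eval_push:
  assumes "group G" "g \<in> X \<rightarrow> carrier G" "set (a # w) \<subseteq> X \<times> UNIV"
  shows "word_eval G g (push a w) = word_eval G g (a # w)"
proof (cases w)
  case (Cons b v)
  interpret group G by (fact assms(1))
  have v: "word_eval G g v \<in> carrier G"
    using assms Cons by (intro word_eval_closed) auto
  have "g (fst a) \<in> carrier G" using assms(2,3) by auto
  then show ?thesis using v Cons
    by (cases a; cases b) (auto simp: word_eval_def opposite_def m_assoc[symmetric])
qed simp

lemma word_eval_hom:
  assumes "group G" "g \<in> X \<rightarrow> carrier G"
  shows "word_eval G g \<in> hom (free_group X) G"
proof (rule homI)
  fix w assume "w \<in> carrier (free_group X)"
  then show "word_eval G g w \<in> carrier G"
    by (intro word_eval_closed[OF assms]) (auto simp: free_group_def)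
next
  interpret group G by (fact assms(1))
  fix u v assume uv: "u \<in> carrier (free_group X)" "v \<in> carrier (free_group X)"
  then have "set u \<subseteq> X \<times> UNIV" by (simp add: free_group_def)
  then have "word_eval G g (foldr push u v) = word_eval G g u \<otimes>\<^bsub>G\<^esub> word_eval G g v"
  proof (induction u)
    case Nil
    have "word_eval G g v \<in> carrier G"
      using uv by (intro word_eval_closed[OF assms]) (auto simp: free_group_def)
    then show ?case by (simp add: word_eval_def)
  next
    case (Cons a u)
    have mem: "set (a # foldr push u v) \<subseteq> X \<times> UNIV"
      using Cons.prems foldr_push_closed[OF uv(2), of u] by (auto simp: free_group_def)
    have "word_eval G g v \<in> carrier G" "word_eval G g u \<in> carrier G"
      using uv Cons.prems by (auto intro!: word_eval_closed[OF assms] simp: free_group_def)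
    moreover have "g (fst a) \<in> carrier G" using Cons.prems assms(2) by auto
    moreover have "word_eval G g (a # w) =
        (if snd a then g (fst a) else inv\<^bsub>G\<^esub> (g (fst a))) \<otimes>\<^bsub>G\<^esub> word_eval G g w" for w
      by (cases a) (simp add: word_eval_def)
    ultimately show ?case
      using word_eval_push[OF assms mem] Cons by (simp add: m_assoc)
  qed
  then show "word_eval G g (u \<otimes>\<^bsub>free_group X\<^esub> v) = word_eval G g u \<otimes>\<^bsub>G\<^esub> word_eval G g v"
    by (simp add: free_group_def)
qed

abbreviation free_group_rank :: "nat \<Rightarrow> nat word monoid" where
  "free_group_rank k \<equiv> free_group {..<k}"

definition word_code :: "nat word \<Rightarrow> nat" where
  "word_code w = list_encode (map (\<lambda>(i, b). 2 * i + (if b then 1 else 0)) w)"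


section \<open>Presentations and the word problem\<close>

definition normal_closure :: "('a, 'b) monoid_scheme \<Rightarrow> 'a set \<Rightarrow> 'a set" where
  "normal_closure F R = \<Inter>{N. N \<lhd> F \<and> R \<subseteq> N}"

text \<open>The presentation has finitely many generators, since only finitely generated groups occur.\<close>

definition recursively_presented :: "('a, 'b) monoid_scheme \<Rightarrow> bool" where
  "recursively_presented G \<longleftrightarrow>
     (\<exists>m R. R \<subseteq> carrier (free_group_rank m) \<and>
        recursively_enumerable (word_code ` R) \<and>
        G \<cong> free_group_rank m Mod normal_closure (free_group_rank m) R)"

definition finite_generating_set :: "('a, 'b) monoid_scheme \<Rightarrow> 'a set \<Rightarrow> bool" where
  "finite_generating_set G S \<longleftrightarrow> finite S \<and> S \<subseteq> carrier G \<and> generate G S = carrier G"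

text \<open>
  To be fed to an algorithm, a word over \<open>S\<close> is turned into a number by means of a numbering \<open>e\<close>
  of \<open>S\<close>. Neither the choice of \<open>e\<close> nor that of \<open>S\<close> affects solvability, so both are existentially
  quantified. On numbers that do not code an element of \<open>F(S)\<close> nothing is required of the
  algorithm, not even termination.
\<close>

definition decidable_word_problem :: "('a, 'b) monoid_scheme \<Rightarrow> bool" where
  "decidable_word_problem G \<longleftrightarrow>
     (\<exists>S e p. finite_generating_set G S \<and> bij_betw e S {..<card S} \<and>
        (\<forall>w \<in> carrier (free_group S).
           rec_eval p [word_code (map (apfst e) w)] =
             Some (if word_eval G (\<lambda>s. s) w = \<one>\<^bsub>G\<^esub> then 1 else 0)))"


section \<open>Laws and lawlessness growth\<close>

definition law :: "('a, 'b) monoid_scheme \<Rightarrow> nat \<Rightarrow> nat word \<Rightarrow> bool" where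
  "law G k w \<longleftrightarrow> w \<in> carrier (free_group_rank k) \<and> w \<noteq> \<one>\<^bsub>free_group_rank k\<^esub> \<and>
     (\<forall>g \<in> {..<k} \<rightarrow> carrier G. word_eval G g w = \<one>\<^bsub>G\<^esub>)"

definition lawless :: "('a, 'b) monoid_scheme \<Rightarrow> bool" where
  "lawless G \<longleftrightarrow> (\<nexists>k w. law G k w)"

definition word_length :: "('a, 'b) monoid_scheme \<Rightarrow> 'a set \<Rightarrow> 'a \<Rightarrow> nat" where
  "word_length G S g =
     (LEAST n. \<exists>w. set w \<subseteq> S \<times> UNIV \<and> length w = n \<and> word_eval G (\<lambda>s. s) w = g)"

definition complexity :: "('a, 'b) monoid_scheme \<Rightarrow> 'a set \<Rightarrow> nat \<Rightarrow> nat word \<Rightarrow> nat" where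
  "complexity G S k w =
     (LEAST n. \<exists>g \<in> {..<k} \<rightarrow> carrier G.
        word_eval G g w \<noteq> \<one>\<^bsub>G\<^esub> \<and> n = (\<Sum>i<k. word_length G S (g i)))"

definition lawlessness_growth :: "('a, 'b) monoid_scheme \<Rightarrow> 'a set \<Rightarrow> nat \<Rightarrow> nat \<Rightarrow> nat" where
  "lawlessness_growth G S k n =
     Max (complexity G S k `
       {w \<in> carrier (free_group_rank k). w \<noteq> \<one>\<^bsub>free_group_rank k\<^esub> \<and> length w \<le> n})"

end

theory Submission
  imports Defs
begin

text \<open>
  The complexity of \<open>w\<close> is the least total length of a tuple of (unreduced) words over \<open>S\<close> whose
  substitution into \<open>w\<close> gives a nontrivial element of \<open>\<Gamma>\<close>. There are finitely many such tuples
  of a given length, and the word problem decides nontriviality. Hence it is decidable whether every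
  nontrivial reduced \<open>w\<close> with \<open>|w| \<le> n\<close> has complexity at most \<open>N\<close>, and the growth function at
  \<open>n\<close> is the least such \<open>N\<close>, which exists since \<open>\<Gamma>\<close> is lawless.
\<close>

section \<open>Computable functions of an environment\<close>

text \<open>The algorithm behind \<open>decidable_word_problem\<close> is reliable only on codes of
  reduced words over its own generating set and may diverge elsewhere, whereas the searches below
  run through all numbers up to a bound. Hence lists are normalized before they reach it: letters
  out of range are deleted and the rest is freely reduced. The passage to the given \<open>S\<close>
  is a substitution of one fixed word per generator, which is finite data built into the program.
  Unreduced words do not disturb the minimum: any list of letters bounds the word length of its
  value from above, and a shortest word attains it. Every finite search becomes a bounded quantifier
  over codes, the bound being the code of a constant list. Lawlessness makes each complexity an
  attained minimum; since only finitely many words have length at most \<open>n\<close>, the one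
  unbounded search, for \<open>N\<close>, then always succeeds.\<close>

text \<open>
  An environment \<open>e\<close> assigns a value to every variable, as in de Bruijn notation; a computable
  function of \<open>e\<close> reads finitely many variables. Binders push their variables in front, so under
  a binder the old environment is \<open>\<lambda>i. e (Suc i)\<close>.
\<close>

definition computable :: "((nat \<Rightarrow> nat) \<Rightarrow> nat) \<Rightarrow> bool" where
  "computable f \<longleftrightarrow> (\<exists>n p. \<forall>e. rec_eval p (map e [0..<n]) = Some (f e))"

definition decidable :: "((nat \<Rightarrow> nat) \<Rightarrow> bool) \<Rightarrow> bool" where
  "decidable P \<longleftrightarrow> computable (\<lambda>e. of_bool (P e))"

definition computable_list :: "((nat \<Rightarrow> nat) \<Rightarrow> nat list) \<Rightarrow> bool" where
  "computable_list F \<longleftrightarrow> computable (\<lambda>e. list_encode (F e))"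

named_theorems computable_intros

lemma rec_eval_Comp_list:
  assumes "\<And>i. i < length gs \<Longrightarrow> rec_eval (gs ! i) xs = Some (h i)"
  shows "rec_eval (Comp f gs) xs = rec_eval f (map h [0..<length gs])"
proof -
  have *: "map (\<lambda>g. rec_eval g xs) gs = map (\<lambda>i. Some (h i)) [0..<length gs]"
    by (rule nth_equalityI) (auto simp: assms)
  show ?thesis
    by (simp only: rec_eval.simps Let_def *) (auto simp: comp_def)
qed

section \<open>Substitution and primitive recursion\<close>

lemma computable_weaken:
  assumes "\<forall>e. rec_eval p (map e [0..<n]) = Some (f e)" "n \<le> m"
  shows "\<exists>p. \<forall>e. rec_eval p (map e [0..<m]) = Some (f e)"
proof (intro exI allI)
  fix e
  have "rec_eval (Comp p (map Proj [0..<n])) (map e [0..<m]) =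
      rec_eval p (map e [0..<length (map Proj [0..<n])])"
    by (rule rec_eval_Comp_list) (use assms(2) in auto)
  then show "rec_eval (Comp p (map Proj [0..<n])) (map e [0..<m]) = Some (f e)"
    using assms(1) by simp
qed

text \<open>Only the \<open>n\<close> variables that \<open>f\<close> reads matter, so the programs
  for \<open>s 0\<close>, ..., \<open>s (n - 1)\<close> need a common arity; the sum
  \<open>M\<close> of their arities serves.\<close>

lemma computable_subst:
  assumes "computable f" "\<And>i. computable (s i)"
  shows "computable (\<lambda>e. f (\<lambda>i. s i e))"
proof -
  obtain n p where p: "\<And>e. rec_eval p (map e [0..<n]) = Some (f e)"
    using assms(1) by (auto simp: computable_def)
  have "\<exists>m q. \<forall>e. rec_eval q (map e [0..<m]) = Some (s i e)" for i
    using assms(2)[of i] by (simp add: computable_def)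
  then obtain m where m: "\<And>i. \<exists>q. \<forall>e. rec_eval q (map e [0..<m i]) = Some (s i e)"
    by metis
  define M where "M = (\<Sum>i<n. m i)"
  have "\<exists>q. \<forall>e. rec_eval q (map e [0..<M]) = Some (s i e)" if "i < n" for i
  proof -
    have "m i \<le> M" unfolding M_def using that by (intro member_le_sum) auto
    with m[of i] computable_weaken show ?thesis by blast
  qed
  then obtain q where q: "\<And>i e. i < n \<Longrightarrow> rec_eval (q i) (map e [0..<M]) = Some (s i e)"
    by metis
  have "rec_eval (Comp p (map q [0..<n])) (map e [0..<M]) = Some (f (\<lambda>i. s i e))" for e
    using rec_eval_Comp_list[of "map q [0..<n]" "map e [0..<M]" "\<lambda>i. s i e" p] q p
    by simp
  then show ?thesis unfolding computable_def by blast
qed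

lemma computable_var [computable_intros]: "computable (\<lambda>e. e i)"
  unfolding computable_def by (intro exI[of _ "Suc i"] exI[of _ "Proj i"]) (simp del: upt_Suc)

lemma computable_rename:
  assumes "computable f"
  shows "computable (\<lambda>e. f (\<lambda>i. e (s i)))"
  using computable_subst[OF assms, of "\<lambda>i e. e (s i)"] by (simp add: computable_var)

lemma computable_unary:
  assumes "\<And>x. rec_eval p [x] = Some (h x)" "computable f"
  shows "computable (\<lambda>e. h (f e))"
proof -
  have "computable (\<lambda>e. h (e 0))"
    unfolding computable_def using assms(1) by (intro exI[of _ 1] exI[of _ p]) simp
  from computable_subst[OF this, of "\<lambda>_. f"] assms(2) show ?thesis by simp
qed

lemma computable_Suc [computable_intros]: "computable f \<Longrightarrow> computable (\<lambda>e. Suc (f e))"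
  by (rule computable_unary[of Succ]) auto

lemma computable_const [computable_intros]: "computable (\<lambda>e. c)"
proof (induction c)
  case 0
  show ?case unfolding computable_def by (intro exI[of _ 0] exI[of _ Zero]) simp
qed (rule computable_Suc)

text \<open>In the hypothesis on \<open>g\<close>, variable 0 is the counter and variable 1 the
  previous value, the order in which \<open>PrimRec\<close> passes them. The recursion is first
  built with variable 0 as its length, and \<open>t\<close> is then substituted for that
  variable.\<close>

lemma computable_rec [computable_intros]:
  assumes "computable t" "computable f" "computable (\<lambda>e. g (e 0) (e 1) (\<lambda>i. e (Suc (Suc i))))"
  shows "computable (\<lambda>e. rec_nat (f e) (\<lambda>m z. g m z e) (t e))"
proof -
  obtain n p where p: "\<forall>e. rec_eval p (map e [0..<n]) = Some (f e)"
    using assms(2) by (auto simp: computable_def)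
  obtain n' q where q: "\<forall>e. rec_eval q (map e [0..<n']) = Some (g (e 0) (e 1) (\<lambda>i. e (Suc (Suc i))))"
    using assms(3) by (auto simp: computable_def)
  define M where "M = max n n'"
  obtain p' where p': "\<And>e. rec_eval p' (map e [0..<M]) = Some (f e)"
    using computable_weaken[OF p, of M] by (auto simp: M_def)
  obtain q' where q': "\<And>e. rec_eval q' (map e [0..<Suc (Suc M)]) = Some (g (e 0) (e 1) (\<lambda>i. e (Suc (Suc i))))"
  proof -
    have "n' \<le> Suc (Suc M)" by (simp add: M_def)
    from computable_weaken[OF q this] that show ?thesis by blast
  qed
  have q'': "rec_eval q' (m # z # map e [0..<M]) = Some (g m z e)" for m z e
    using q'[of "case_nat m (case_nat z e)"] unfolding map_upt_Suc by simp
  have "rec_eval (PrimRec p' q') (map e [0..<Suc M]) =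
      Some (rec_nat (f (\<lambda>i. e (Suc i))) (\<lambda>m z. g m z (\<lambda>i. e (Suc i))) (e 0))" for e
  proof -
    have "rec_nat (rec_eval p' ys) (\<lambda>m r. case r of None \<Rightarrow> None | Some z \<Rightarrow> rec_eval q' (m # z # ys)) k
      = Some (rec_nat (f d) (\<lambda>m z. g m z d) k)" if "ys = map d [0..<M]" for ys d k
      unfolding that by (induction k) (auto simp: p' q'')
    then show ?thesis unfolding map_upt_Suc by simp
  qed
  then have "computable (\<lambda>e. rec_nat (f (\<lambda>i. e (Suc i))) (\<lambda>m z. g m z (\<lambda>i. e (Suc i))) (e 0))"
    unfolding computable_def by blast
  from computable_subst[OF this, of "case_nat t (\<lambda>i e. e i)"] show ?thesis
    using assms(1) computable_var by (auto split: nat.split)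
qed

section \<open>Arithmetic and Boolean operations\<close>

lemma computable_add [computable_intros]:
  assumes "computable f" "computable g"
  shows "computable (\<lambda>e. f e + g e)"
proof -
  have "rec_nat a (\<lambda>_ z. Suc z) b = a + b" for a b :: nat by (induction b) auto
  moreover have "computable (\<lambda>e. rec_nat (f e) (\<lambda>_ z. Suc z) (g e))" by (intro computable_intros assms)
  ultimately show ?thesis by simp
qed

lemma computable_mult [computable_intros]:
  assumes "computable f" "computable g"
  shows "computable (\<lambda>e. f e * g e)"
proof -
  \<comment> \<open>Both factors are variables at first, so that no shifted copy of \<open>f\<close>
    appears under the recursion.\<close>
  have "computable (\<lambda>e. rec_nat 0 (\<lambda>_ z. z + e 0) (e 1))" by (intro computable_intros)
  from computable_subst[OF this, of "case_nat f (\<lambda>_. g)"]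
  have "computable (\<lambda>e. rec_nat 0 (\<lambda>_ z. z + f e) (g e))" using assms by (auto split: nat.split)
  moreover have "rec_nat 0 (\<lambda>_ z. z + a) b = a * b" for a b :: nat by (induction b) auto
  ultimately show ?thesis by simp
qed

lemma computable_diff [computable_intros]:
  assumes "computable f" "computable g"
  shows "computable (\<lambda>e. f e - g e)"
proof -
  have pred: "computable (\<lambda>e. h e - Suc 0)" if "computable h" for h
  proof -
    have "rec_nat 0 (\<lambda>m _. m) a = a - Suc 0" for a :: nat by (cases a) auto
    moreover have "computable (\<lambda>e. rec_nat 0 (\<lambda>m _. m) (h e))" by (intro computable_intros that)
    ultimately show ?thesis by simp
  qed
  have "rec_nat a (\<lambda>_ z. z - Suc 0) b = a - b" for a b :: nat by (induction b) auto
  moreover have "computable (\<lambda>e. rec_nat (f e) (\<lambda>_ z. z - Suc 0) (g e))" by (intro computable_intros assms pred)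
  ultimately show ?thesis by simp
qed

lemma decidable_not [computable_intros]:
  assumes "decidable P"
  shows "decidable (\<lambda>e. \<not> P e)"
proof -
  have "of_bool (\<not> P e) = 1 - (of_bool (P e) :: nat)" for e by simp
  then show ?thesis using assms unfolding decidable_def by (auto intro!: computable_intros)
qed

lemma decidable_conj [computable_intros]:
  assumes "decidable P" "decidable Q"
  shows "decidable (\<lambda>e. P e \<and> Q e)"
  using assms unfolding decidable_def of_bool_conj by (intro computable_intros)

lemma decidable_imp [computable_intros]:
  assumes "decidable P" "decidable Q"
  shows "decidable (\<lambda>e. P e \<longrightarrow> Q e)"
proof -
  have "decidable (\<lambda>e. \<not> (P e \<and> \<not> Q e))" by (intro computable_intros assms)
  then show ?thesis by simp
qed

lemma computable_if [computable_intros]: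
  assumes "decidable P" "computable f" "computable g"
  shows "computable (\<lambda>e. if P e then f e else g e)"
proof -
  have "(if P e then f e else g e) = of_bool (P e) * f e + (1 - of_bool (P e)) * g e" for e
    by simp
  moreover have "computable (\<lambda>e. of_bool (P e) * f e + (1 - of_bool (P e)) * g e)"
    using assms unfolding decidable_def by (intro computable_intros)
  ultimately show ?thesis by simp
qed

lemma decidable_le [computable_intros]:
  assumes "computable f" "computable g"
  shows "decidable (\<lambda>e. f e \<le> g e)"
proof -
  have "of_bool (f e \<le> g e) = 1 - (f e - g e)" for e by auto
  moreover have "computable (\<lambda>e. 1 - (f e - g e))" by (intro computable_intros assms)
  ultimately show ?thesis by (simp add: decidable_def)
qed

lemma decidable_less [computable_intros]:
  assumes "computable f" "computable g"
  shows "decidable (\<lambda>e. f e < g e)"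
proof -
  have "decidable (\<lambda>e. Suc (f e) \<le> g e)" by (intro computable_intros assms)
  then show ?thesis by (simp add: Suc_le_eq)
qed

lemma decidable_eq [computable_intros]:
  assumes "computable f" "computable g"
  shows "decidable (\<lambda>e. f e = g e)"
proof -
  have "decidable (\<lambda>e. f e \<le> g e \<and> g e \<le> f e)" by (intro computable_intros assms)
  then show ?thesis by (simp add: eq_iff)
qed

section \<open>Bounded quantifiers and unbounded search\<close>

lemma decidable_all_le [computable_intros]:
  assumes "computable t" "decidable (\<lambda>e. P (e 0) (\<lambda>i. e (Suc i)))"
  shows "decidable (\<lambda>e. \<forall>x\<le>t e. P x e)"
proof -
  \<comment> \<open>Inside the recursion the accumulator occupies variable 1, so the outer
    environment moves up by one more place.\<close>
  have "computable (\<lambda>e. of_bool (P (e 0) (\<lambda>i. e (Suc (Suc i)))))"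
    using computable_subst[OF assms(2)[unfolded decidable_def], of "case_nat (\<lambda>e. e 0) (\<lambda>i e. e (Suc (Suc i)))"]
      computable_var by (auto split: nat.split)
  \<comment> \<open>A product of truth values; the inclusive bound \<open>t e\<close> calls for
    \<open>Suc (t e)\<close> factors.\<close>
  then have "computable (\<lambda>e. rec_nat 1 (\<lambda>m z. z * of_bool (P m e)) (Suc (t e)))"
    by (intro computable_intros assms(1))
  moreover have "rec_nat 1 (\<lambda>m z. z * of_bool (P m e)) (Suc b) = (of_bool (\<forall>x\<le>b. P x e) :: nat)" for b e
    by (induction b) (auto simp: le_Suc_eq)
  ultimately show ?thesis by (simp add: decidable_def)
qed

lemma decidable_ex_le [computable_intros]:
  assumes "computable t" "decidable (\<lambda>e. P (e 0) (\<lambda>i. e (Suc i)))"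
  shows "decidable (\<lambda>e. \<exists>x\<le>t e. P x e)"
proof -
  have "decidable (\<lambda>e. \<not> (\<forall>x\<le>t e. \<not> P x e))" by (intro computable_intros assms)
  then show ?thesis by simp
qed

text \<open>\<open>Minim\<close> looks for a zero, so the program evaluates the negation of
  \<open>P\<close>. A witness is required in every environment because \<open>computable\<close>
  leaves no room for divergence.\<close>

lemma computable_Least:
  assumes "decidable (\<lambda>e. P (e 0) (\<lambda>i. e (Suc i)))" "\<And>e. \<exists>x. P x e"
  shows "computable (\<lambda>e. LEAST x. P x e)"
proof -
  have "computable (\<lambda>e. of_bool (\<not> P (e 0) (\<lambda>i. e (Suc i))))"
    using decidable_not[OF assms(1)] unfolding decidable_def .
  then obtain n p where p: "\<forall>e. rec_eval p (map e [0..<n]) = Some (of_bool (\<not> P (e 0) (\<lambda>i. e (Suc i))))"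
    by (auto simp: computable_def)
  obtain q where q: "\<And>e. rec_eval q (map e [0..<Suc n]) = Some (of_bool (\<not> P (e 0) (\<lambda>i. e (Suc i))))"
    using computable_weaken[OF p, of "Suc n"] by auto
  have q': "rec_eval q (m # map e [0..<n]) = Some (of_bool (\<not> P m e))" for m e
    using q[of "case_nat m e"] unfolding map_upt_Suc by simp
  have "rec_eval (Minim q) (map e [0..<n]) = Some (LEAST x. P x e)" for e
  proof -
    define l where "l = (LEAST x. P x e)"
    have "P l e" unfolding l_def using assms(2)[of e] by (rule LeastI_ex)
    moreover have "\<not> P m e" if "m < l" for m using that unfolding l_def by (rule not_less_Least)
    ultimately have "rec_eval q (l # map e [0..<n]) = Some 0 \<and>
        (\<forall>m<l. \<exists>y. rec_eval q (m # map e [0..<n]) = Some (Suc y))"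
      by (simp add: q')
    moreover have "(rec_eval q (m # map e [0..<n]) = Some 0) = P m e" for m by (simp add: q')
    moreover have "rec_eval (Minim q) (map e [0..<n]) =
        Some (LEAST n'. rec_eval q (n' # map e [0..<n]) = Some 0)"
      unfolding rec_eval.simps(6) using calculation(1) by (intro if_P) blast
    ultimately show ?thesis by (simp only:)
  qed
  then show ?thesis unfolding computable_def by blast
qed

section \<open>Division and pairing\<close>

lemma computable_div [computable_intros]:
  assumes "computable f" "computable g"
  shows "computable (\<lambda>e. f e div g e)"
proof -
  \<comment> \<open>The disjunct \<open>b = 0\<close> makes the search succeed at once with 0, which
    is the value of \<open>a div 0\<close>.\<close>
  define D :: "nat \<Rightarrow> nat \<Rightarrow> nat" where "D a b = (LEAST q. b = 0 \<or> a < Suc q * b)" for a b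
  have ex: "\<exists>q. b = 0 \<or> a < Suc q * b" for a b :: nat
  proof (cases "b = 0")
    case False
    then have "Suc a * 1 \<le> Suc a * b" by (intro mult_le_mono) auto
    then have "a < Suc a * b" by simp
    then show ?thesis by blast
  qed simp
  have D: "D a b = a div b" for a b
  proof (cases "b = 0")
    case False
    show ?thesis unfolding D_def
    proof (rule Least_equality)
      show "b = 0 \<or> a < Suc (a div b) * b"
        using False dividend_less_div_times[of b a] by simp
      show "a div b \<le> q" if "b = 0 \<or> a < Suc q * b" for q
      proof -
        have "a < Suc q * b" using that False by blast
        then have "a div b < Suc q" by (rule less_mult_imp_div_less)
        then show ?thesis by simp
      qed
    qed
  qed (auto simp: D_def)
  \<comment> \<open>The disjunction is expressed by negation and conjunction, which have closure
    rules.\<close>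
  have "computable (\<lambda>e. LEAST q. \<not> (\<not> g e = 0 \<and> \<not> f e < Suc q * g e))"
  proof (rule computable_Least)
    note shifted = assms[THEN computable_rename, of Suc]
    show "decidable (\<lambda>e. \<not> (\<not> g (\<lambda>i. e (Suc i)) = 0 \<and> \<not> f (\<lambda>i. e (Suc i)) < Suc (e 0) * g (\<lambda>i. e (Suc i))))"
      by (rule computable_intros shifted)+
    show "\<exists>q. \<not> (\<not> g e = 0 \<and> \<not> f e < Suc q * g e)" for e
      using ex[of "g e" "f e"] by blast
  qed
  moreover have "(LEAST q. \<not> (\<not> b = 0 \<and> \<not> a < Suc q * b)) = a div b" for a b :: nat
    unfolding D[symmetric] D_def de_Morgan_conj not_not ..
  ultimately show ?thesis by simp
qed

lemma computable_mod [computable_intros]: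
  assumes "computable f" "computable g"
  shows "computable (\<lambda>e. f e mod g e)"
  unfolding modulo_nat_def by (intro computable_intros assms)

lemma decidable_even [computable_intros]:
  assumes "computable f"
  shows "decidable (\<lambda>e. even (f e))"
  unfolding even_iff_mod_2_eq_zero by (intro computable_intros assms)

lemma computable_prod_encode [computable_intros]:
  assumes "computable f" "computable g"
  shows "computable (\<lambda>e. prod_encode (f e, g e))"
  unfolding prod_encode_def triangle_def prod.case by (intro computable_intros assms)

text \<open>Decoding is obtained from encoding by search. A coordinate never exceeds the code of its
  pair, so the other coordinate can be sought below \<open>c\<close>.\<close>

lemma fst_prod_decode_Least:
  "fst (prod_decode c) = (LEAST a. \<exists>b\<le>c. prod_encode (a, b) = c)"
proof (rule sym, rule Least_equality)
  show "\<exists>b\<le>c. prod_encode (fst (prod_decode c), b) = c"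
    by (metis le_prod_encode_2 prod.collapse prod_decode_inverse)
qed auto

lemma snd_prod_decode_Least:
  "snd (prod_decode c) = (LEAST b. \<exists>a\<le>c. prod_encode (a, b) = c)"
proof (rule sym, rule Least_equality)
  show "\<exists>a\<le>c. prod_encode (a, snd (prod_decode c)) = c"
    by (metis le_prod_encode_1 prod.collapse prod_decode_inverse)
qed auto

lemma computable_fst [computable_intros]:
  assumes "computable f"
  shows "computable (\<lambda>e. fst (prod_decode (f e)))"
proof -
  have "computable (\<lambda>e. fst (prod_decode (e 0)))" unfolding fst_prod_decode_Least
  proof (rule computable_Least)
    show "\<exists>a. \<exists>b\<le>e 0. prod_encode (a, b) = e 0" for e :: "nat \<Rightarrow> nat"
      by (metis le_prod_encode_2 prod.collapse prod_decode_inverse)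
  qed (intro computable_intros)
  from computable_subst[OF this, of "\<lambda>_. f"] assms show ?thesis by simp
qed

lemma computable_snd [computable_intros]:
  assumes "computable f"
  shows "computable (\<lambda>e. snd (prod_decode (f e)))"
proof -
  have "computable (\<lambda>e. snd (prod_decode (e 0)))" unfolding snd_prod_decode_Least
  proof (rule computable_Least)
    show "\<exists>b. \<exists>a\<le>e 0. prod_encode (a, b) = e 0" for e :: "nat \<Rightarrow> nat"
      by (metis le_prod_encode_1 prod.collapse prod_decode_inverse)
  qed (intro computable_intros)
  from computable_subst[OF this, of "\<lambda>_. f"] assms show ?thesis by simp
qed

section \<open>Operations on lists of numbers\<close>

lemma computable_list_rename: "computable_list F \<Longrightarrow> computable_list (\<lambda>e. F (\<lambda>i. e (s i)))"
  unfolding computable_list_def by (rule computable_rename)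

lemma computable_list_const [computable_intros]: "computable_list (\<lambda>e. xs)"
  unfolding computable_list_def by (rule computable_const)

lemma computable_list_decode [computable_intros]:
  "computable f \<Longrightarrow> computable_list (\<lambda>e. list_decode (f e))"
  unfolding computable_list_def by simp

lemma computable_list_encode [computable_intros]:
  "computable_list F \<Longrightarrow> computable (\<lambda>e. list_encode (F e))"
  unfolding computable_list_def by simp

lemma computable_list_Cons [computable_intros]:
  "computable f \<Longrightarrow> computable_list F \<Longrightarrow> computable_list (\<lambda>e. f e # F e)"
  unfolding computable_list_def list_encode.simps by (intro computable_Suc computable_prod_encode)

lemma computable_list_if [computable_intros]:
  assumes "decidable P" "computable_list F" "computable_list H"
  shows "computable_list (\<lambda>e. if P e then F e else H e)"
  using assms unfolding computable_list_def if_distrib[of list_encode] by (rule computable_if)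

lemma decidable_list_eq [computable_intros]:
  assumes "computable_list F" "computable_list H"
  shows "decidable (\<lambda>e. F e = H e)"
proof -
  have "decidable (\<lambda>e. list_encode (F e) = list_encode (H e))" by (intro computable_intros assms)
  then show ?thesis by (simp add: list_encode_eq)
qed

lemma computable_list_tl [computable_intros]:
  assumes "computable_list F"
  shows "computable_list (\<lambda>e. tl (F e))"
proof -
  \<comment> \<open>A nonempty list is coded by the successor of the pair of its head and the code
    of its tail; \<open>[]\<close> has code 0.\<close>
  have "list_encode (tl xs) = (if xs = [] then 0 else snd (prod_decode (list_encode xs - 1)))" for xs
    by (cases xs) auto
  moreover have "computable (\<lambda>e. if F e = [] then 0 else snd (prod_decode (list_encode (F e) - 1)))"
    by (intro computable_intros assms)
  ultimately show ?thesis by (simp add: computable_list_def)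
qed

(* hd [] is an unspecified constant, and constants are computable *)
lemma computable_hd [computable_intros]:
  assumes "computable_list F"
  shows "computable (\<lambda>e. hd (F e))"
proof -
  have "hd xs = (if xs = [] then hd [] else fst (prod_decode (list_encode xs - 1)))" for xs
    by (cases xs) auto
  then have "(\<lambda>e. hd (F e)) = (\<lambda>e. if F e = [] then hd [] else fst (prod_decode (list_encode (F e) - 1)))"
    by blast
  moreover have "computable (\<lambda>e. if F e = [] then hd [] else fst (prod_decode (list_encode (F e) - 1)))"
    by (intro computable_intros assms)
  ultimately show ?thesis by (rule ssubst[where P = computable])
qed

lemma computable_list_drop [computable_intros]:
  assumes "computable t" "computable_list F"
  shows "computable_list (\<lambda>e. drop (t e) (F e))"
proof -
  have "list_encode (drop i xs) = rec_nat (list_encode xs) (\<lambda>_ z. list_encode (tl (list_decode z))) i" for i xs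
  proof (induction i)
    case (Suc i)
    show ?case by (simp add: Suc[symmetric] drop_Suc tl_drop)
  qed simp
  moreover have "computable (\<lambda>e. rec_nat (list_encode (F e)) (\<lambda>_ z. list_encode (tl (list_decode z))) (t e))"
    by (intro computable_intros assms)
  ultimately show ?thesis unfolding computable_list_def by (simp only:)
qed

lemma computable_length [computable_intros]:
  assumes "computable_list F"
  shows "computable (\<lambda>e. length (F e))"
proof -
  have "length xs = (LEAST i. drop i xs = [])" for xs :: "nat list"
    by (rule sym, rule Least_equality) auto
  moreover have "computable (\<lambda>e. LEAST i. drop i (F e) = [])"
  proof (rule computable_Least)
    show "decidable (\<lambda>e. drop (e 0) (F (\<lambda>i. e (Suc i))) = [])"
      by (intro computable_intros computable_list_rename[OF assms])
  qed auto
  ultimately show ?thesis by (simp only:)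
qed

text \<open>\<open>foldr\<close> works from the end of the list: after \<open>j\<close> steps the
  accumulator is the fold of the suffix of length \<open>j\<close>, and the next entry is the head
  of the suffix of length \<open>Suc j\<close>. Folding thus becomes primitive recursion on the
  length.\<close>

lemma foldr_eq_rec_nat:
  assumes "j \<le> length xs"
  shows "foldr g (drop (length xs - j) xs) a =
    rec_nat a (\<lambda>j. g (hd (drop (length xs - Suc j) xs))) j"
  using assms
proof (induction j)
  case (Suc j)
  then have "drop (length xs - Suc j) xs =
      hd (drop (length xs - Suc j) xs) # drop (length xs - j) xs"
    by (metis Cons_nth_drop_Suc Suc_diff_Suc Suc_le_eq diff_less hd_drop_conv_nth
        less_le_trans zero_less_Suc)
  then show ?case using Suc by (metis Suc_leD comp_apply foldr.simps(2) old.nat.simps(7))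
qed simp

lemma computable_foldr:
  assumes "computable_list F" "computable a" "computable (\<lambda>e. g (e 0) (e 1) (\<lambda>i. e (Suc (Suc i))))"
  shows "computable (\<lambda>e. foldr (\<lambda>x z. g x z e) (F e) (a e))"
proof -
  have "foldr (\<lambda>x z. g x z e) (F e) (a e) =
      rec_nat (a e) (\<lambda>j z. g (hd (drop (length (F e) - Suc j) (F e))) z e) (length (F e))" for e
    using foldr_eq_rec_nat[of "length (F e)" "F e" "\<lambda>x z. g x z e" "a e"] by simp
  moreover have "computable (\<lambda>e. rec_nat (a e)
      (\<lambda>j z. g (hd (drop (length (F e) - Suc j) (F e))) z e) (length (F e)))"
  proof (rule computable_rec)
    have F: "computable_list (\<lambda>e. F (\<lambda>i. e (Suc (Suc i))))"
      by (rule computable_list_rename[OF assms(1)])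
    \<comment> \<open>\<open>h\<close> recovers the current entry from the counter in variable 0;
      putting it in place of that variable turns \<open>g\<close> into the step function of the
      recursion.\<close>
    define h where "h = (\<lambda>e. hd (drop (length (F (\<lambda>i. e (Suc (Suc i)))) - Suc (e 0))
        (F (\<lambda>i. e (Suc (Suc i))))))"
    have "computable h" unfolding h_def by (intro computable_intros F)
    then have "computable (case_nat h (\<lambda>i e. e (Suc i)) i)" for i by (cases i) (auto intro: computable_var)
    from computable_subst[of _ "case_nat h (\<lambda>i e. e (Suc i))", OF assms(3) this]
    show "computable (\<lambda>e. g (hd (drop (length (F (\<lambda>i. e (Suc (Suc i)))) - Suc (e 0))
        (F (\<lambda>i. e (Suc (Suc i)))))) (e 1) (\<lambda>i. e (Suc (Suc i))))"
      by (simp add: h_def)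
  qed (intro computable_intros assms)+
  ultimately show ?thesis by simp
qed

lemma computable_list_foldr:
  assumes "computable_list F" "computable_list A" "computable_list (\<lambda>e. g (e 0) (list_decode (e 1)) (\<lambda>i. e (Suc (Suc i))))"
  shows "computable_list (\<lambda>e. foldr (\<lambda>x z. g x z e) (F e) (A e))"
proof -
  have "list_encode (foldr h xs a) =
      foldr (\<lambda>x z. list_encode (h x (list_decode z))) xs (list_encode a)"
    for h :: "nat \<Rightarrow> nat list \<Rightarrow> nat list" and xs a
  proof (induction xs)
    case (Cons x xs)
    show ?case by (simp add: Cons[symmetric])
  qed simp
  moreover have "computable (\<lambda>e. foldr (\<lambda>x z. list_encode (g x (list_decode z) e)) (F e) (list_encode (A e)))"
    using assms unfolding computable_list_def by (intro computable_foldr) (auto simp: computable_list_def)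
  ultimately show ?thesis by (simp add: computable_list_def)
qed

lemma computable_list_append [computable_intros]:
  assumes "computable_list F" "computable_list H"
  shows "computable_list (\<lambda>e. F e @ H e)"
proof -
  have "computable_list (\<lambda>e. foldr (\<lambda>x z. x # z) (F e) (H e))"
    by (rule computable_list_foldr) (intro assms computable_intros)+
  moreover have "foldr (\<lambda>x z. x # z) xs ys = xs @ ys" for xs ys :: "nat list"
    by (induction xs) auto
  ultimately show ?thesis by simp
qed

lemma computable_list_rev [computable_intros]:
  assumes "computable_list F"
  shows "computable_list (\<lambda>e. rev (F e))"
proof -
  have "computable_list (\<lambda>e. foldr (\<lambda>x z. z @ [x]) (F e) [])"
    by (rule computable_list_foldr) (intro assms computable_intros)+
  moreover have "foldr (\<lambda>x z. z @ [x]) xs [] = rev xs" for xs :: "nat list"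
    by (induction xs) auto
  ultimately show ?thesis by simp
qed

lemma computable_list_concat_map [computable_intros]:
  assumes "computable_list F" "computable_list (\<lambda>e. g (e 0) (\<lambda>i. e (Suc i)))"
  shows "computable_list (\<lambda>e. concat (map (\<lambda>x. g x e) (F e)))"
proof -
  have "computable_list (\<lambda>e. g (e 0) (\<lambda>i. e (Suc (Suc i))))"
    using computable_list_rename[OF assms(2), of "case_nat 0 (\<lambda>i. Suc (Suc i))"] by simp
  then have "computable_list (\<lambda>e. foldr (\<lambda>x z. g x e @ z) (F e) [])"
    by (intro computable_list_foldr computable_intros assms(1))
  moreover have "foldr (\<lambda>x z. h x @ z) xs [] = concat (map h xs)"
    for h :: "nat \<Rightarrow> nat list" and xs
    by (induction xs) auto
  ultimately show ?thesis by simp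
qed

lemma computable_list_map [computable_intros]:
  assumes "computable_list F" "computable (\<lambda>e. g (e 0) (\<lambda>i. e (Suc i)))"
  shows "computable_list (\<lambda>e. map (\<lambda>x. g x e) (F e))"
proof -
  have "computable_list (\<lambda>e. concat (map (\<lambda>x. [g x e]) (F e)))" by (intro computable_intros assms)
  then show ?thesis by simp
qed

lemma computable_list_filter [computable_intros]:
  assumes "computable_list F" "decidable (\<lambda>e. P (e 0) (\<lambda>i. e (Suc i)))"
  shows "computable_list (\<lambda>e. filter (\<lambda>x. P x e) (F e))"
proof -
  have "computable_list (\<lambda>e. concat (map (\<lambda>x. if P x e then [x] else []) (F e)))"
    by (intro computable_intros assms)
  moreover have "concat (map (\<lambda>x. if Q x then [x] else []) xs) = filter Q xs" for Q and xs :: "nat list"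
    by (induction xs) auto
  ultimately show ?thesis by simp
qed

text \<open>\<open>p\<close> may diverge away from the values of \<open>f\<close>. This is the entry
  point for an algorithm that is only specified on some inputs.\<close>

lemma computable_partial:
  assumes "computable f" "\<And>e. rec_eval p [f e] = Some (h e)"
  shows "computable h"
proof -
  obtain n q where q: "\<And>e. rec_eval q (map e [0..<n]) = Some (f e)"
    using assms(1) by (auto simp: computable_def)
  have "rec_eval (Comp p [q]) (map e [0..<n]) = Some (h e)" for e
    using q[of e] assms(2)[of e] by simp
  then show ?thesis unfolding computable_def by blast
qed

lemma computable_on_if_computable:
  assumes "computable (\<lambda>e. f (e 0))"
  shows "computable_on D f"
proof -
  obtain n p where p: "\<And>e. rec_eval p (map e [0..<n]) = Some (f (e 0))"
    using assms by (auto simp: computable_def)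
  \<comment> \<open>The single argument feeds variable 0; every other variable that \<open>p\<close>
    reads is set to 0.\<close>
  have "rec_eval (Comp p (map (\<lambda>i. if i = 0 then Proj 0 else Zero) [0..<n])) [x] = Some (f x)" for x
    using rec_eval_Comp_list[of "map (\<lambda>i. if i = 0 then Proj 0 else Zero) [0..<n]" "[x]"
        "\<lambda>i. if i = 0 then x else 0" p] p[of "\<lambda>i. if i = 0 then x else 0"] by (simp del: rec_eval.simps(4))
  then show ?thesis unfolding computable_on_def by blast
qed

section \<open>Words coded by lists of numbers\<close>

text \<open>The inverse of the numbering of letters inside \<open>word_code\<close>: odd numbers are
  generators, even numbers their inverses. It is a bijection, so every list of numbers codes a
  word.\<close>

definition letter :: "nat \<Rightarrow> nat \<times> bool" where
  "letter a = (a div 2, odd a)"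

definition letter_code :: "nat \<times> bool \<Rightarrow> nat" where
  "letter_code = (\<lambda>(i, b). 2 * i + (if b then 1 else 0))"

definition flip :: "nat \<Rightarrow> nat" where
  "flip a = (if even a then Suc a else a - 1)"

definition push_code :: "nat \<Rightarrow> nat list \<Rightarrow> nat list" where
  "push_code a x =
     (if x = [] then [a] else if \<not> a = hd x \<and> a div 2 = hd x div 2 then tl x else a # x)"

definition reduce :: "nat list \<Rightarrow> nat list" where
  "reduce x = foldr push_code x []"

definition subst :: "(nat \<Rightarrow> nat list) \<Rightarrow> nat list \<Rightarrow> nat list" where
  "subst U x = concat (map (\<lambda>a. if even a then rev (map flip (U (a div 2))) else U (a div 2)) x)"

definition code_eval :: "('g, 'b) monoid_scheme \<Rightarrow> (nat \<Rightarrow> 'g) \<Rightarrow> nat list \<Rightarrow> 'g" where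
  "code_eval G g x = word_eval G g (map letter x)"

lemma letter_letter_code [simp]: "letter (letter_code l) = l"
  by (cases l) (auto simp: letter_def letter_code_def)

lemma letter_code_letter [simp]: "letter_code (letter a) = a"
  by (auto simp: letter_def letter_code_def)

lemma letter_flip [simp]: "letter (flip a) = apsnd Not (letter a)"
  by (auto simp: letter_def flip_def elim!: oddE)

lemma word_code_letters [simp]: "word_code (map letter x) = list_encode x"
  unfolding word_code_def letter_code_def[symmetric] by (simp add: comp_def)

lemma map_letter_letter_code [simp]: "map letter (map letter_code w) = w"
  by (simp add: comp_def)

lemma opposite_letter: "opposite (letter a) (letter b) \<longleftrightarrow> a \<noteq> b \<and> a div 2 = b div 2"
  by (auto simp: opposite_def letter_def) presburger

lemma map_letter_push_code: "map letter (push_code a x) = push (letter a) (map letter x)"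
  by (cases x) (auto simp: push_code_def opposite_letter)

lemma map_letter_reduce: "map letter (reduce x) = foldr push (map letter x) []"
  unfolding reduce_def by (induction x) (auto simp: map_letter_push_code)

lemma map_letter_reduce_carrier:
  assumes "set x \<subseteq> {..<2 * m}"
  shows "map letter (reduce x) \<in> carrier (free_group_rank m)"
  unfolding map_letter_reduce
proof (rule foldr_push_closed)
  show "[] \<in> carrier (free_group_rank m)" by (simp add: free_group_def reduced_def)
  show "set (map letter x) \<subseteq> {..<m} \<times> UNIV" using assms by (auto simp: letter_def)
qed

text \<open>Together with \<open>map_letter_reduce_carrier\<close>, this allows a quantifier over
  reduced words to be replaced by one over all lists, each normalized first.\<close>

lemma reduce_letter_code:
  assumes "w \<in> carrier (free_group_rank m)"
  shows "reduce (map letter_code w) = map letter_code w"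
    and "set (map letter_code w) \<subseteq> {..<2 * m}"
proof -
  have "map letter (reduce (map letter_code w)) = w"
    using assms unfolding map_letter_reduce map_letter_letter_code
    by (intro foldr_push_Nil) (simp add: free_group_def)
  then have "map letter_code (map letter (reduce (map letter_code w))) = map letter_code w" by simp
  then show "reduce (map letter_code w) = map letter_code w" by (simp add: comp_def)
  show "set (map letter_code w) \<subseteq> {..<2 * m}"
    using assms by (fastforce simp: free_group_def letter_code_def split: if_splits)
qed

lemma computable_flip [computable_intros]: "computable f \<Longrightarrow> computable (\<lambda>e. flip (f e))"
  unfolding flip_def by (intro computable_intros)

lemma computable_list_reduce [computable_intros]:
  assumes "computable_list F"
  shows "computable_list (\<lambda>e. reduce (F e))"
  unfolding reduce_def push_code_def by (rule computable_list_foldr) (intro assms computable_intros)+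

lemma computable_list_subst [computable_intros]:
  assumes "computable_list F" "computable_list (\<lambda>e. U (e 0) (\<lambda>i. e (Suc i)))"
  shows "computable_list (\<lambda>e. subst (\<lambda>i. U i e) (F e))"
proof -
  \<comment> \<open>The variable bound in \<open>subst\<close> is a letter, whereas \<open>U\<close>
    expects the index of its generator.\<close>
  have "computable (case_nat (\<lambda>e. e 0 div 2) (\<lambda>i e. e (Suc i)) i)" for i
    by (cases i) (auto intro!: computable_intros)
  from computable_subst[of _ "case_nat (\<lambda>e. e 0 div 2) (\<lambda>i e. e (Suc i))",
      OF assms(2)[unfolded computable_list_def] this]
  have "computable_list (\<lambda>e. U (e 0 div 2) (\<lambda>i. e (Suc i)))" by (simp add: computable_list_def)
  then show ?thesis unfolding subst_def by (intro computable_intros assms)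
qed

section \<open>Values of coded words in a group\<close>

context group
begin

lemma code_eval_Nil [simp]: "code_eval G g [] = \<one>"
  by (simp add: code_eval_def word_eval_def)

lemma code_eval_Cons:
  "code_eval G g (a # x) = (if odd a then g (a div 2) else inv (g (a div 2))) \<otimes> code_eval G g x"
  by (simp add: code_eval_def word_eval_def letter_def)

lemma code_eval_closed [simp, intro]:
  assumes "g \<in> UNIV \<rightarrow> carrier G"
  shows "code_eval G g x \<in> carrier G"
  unfolding code_eval_def by (rule word_eval_closed[OF is_group assms]) simp

lemma code_eval_append:
  assumes g: "g \<in> UNIV \<rightarrow> carrier G"
  shows "code_eval G g (x @ y) = code_eval G g x \<otimes> code_eval G g y"
proof (induction x)
  case (Cons a x)
  have "g i \<in> carrier G" for i using g by auto
  then show ?case using g by (simp add: Cons code_eval_Cons m_assoc)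
qed (use g in simp)

lemma code_eval_inverse:
  assumes g: "g \<in> UNIV \<rightarrow> carrier G"
  shows "code_eval G g (rev (map flip x)) = inv (code_eval G g x)"
proof (induction x)
  case (Cons a x)
  have gi: "g i \<in> carrier G" for i using g by auto
  have "code_eval G g [flip a] = (if odd a then inv (g (a div 2)) else g (a div 2))"
    using gi by (auto simp: code_eval_Cons flip_def elim!: oddE)
  then show ?case using g gi
    by (simp add: Cons code_eval_append code_eval_Cons inv_mult_group)
qed simp

text \<open>It serves two purposes: the change of generating set, with \<open>U i\<close> a word for
  a new generator, and the evaluation of a word at a tuple of group elements given by words.\<close>

lemma code_eval_subst:
  assumes g: "g \<in> UNIV \<rightarrow> carrier G"
  shows "code_eval G g (subst U x) = code_eval G (\<lambda>i. code_eval G g (U i)) x"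
  by (induction x) (simp_all add: subst_def code_eval_append g code_eval_inverse code_eval_Cons)

lemma code_eval_reduce:
  assumes g: "g \<in> UNIV \<rightarrow> carrier G"
  shows "code_eval G g (reduce x) = code_eval G g x"
proof (induction x)
  case (Cons a x)
  have "code_eval G g (reduce (a # x)) = word_eval G g (letter a # map letter (reduce x))"
    using word_eval_push[OF is_group g, of "letter a" "map letter (reduce x)"]
    by (simp add: code_eval_def reduce_def map_letter_push_code)
  then show ?case using Cons by (simp add: code_eval_def word_eval_def)
qed (simp add: reduce_def)

lemma code_eval_filter:
  assumes g: "g \<in> UNIV \<rightarrow> carrier G" and "\<And>i. m \<le> i \<Longrightarrow> g i = \<one>"
  shows "code_eval G g (filter (\<lambda>a. a < 2 * m) x) = code_eval G g x"
proof (induction x)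
  case (Cons a x)
  have "m \<le> a div 2" if "\<not> a < 2 * m" using that by linarith
  then have "g (a div 2) = \<one>" if "\<not> a < 2 * m" using that assms(2) by simp
  then show ?case using g Cons by (auto simp: code_eval_Cons)
qed simp

lemma code_eval_cong:
  assumes "\<And>a. a \<in> set x \<Longrightarrow> g (a div 2) = h (a div 2)"
  shows "code_eval G g x = code_eval G h x"
  using assms by (induction x) (auto simp: code_eval_Cons)

lemma generate_code_eval:
  assumes g: "g \<in> UNIV \<rightarrow> carrier G" and "h \<in> generate G (range g)"
  shows "\<exists>x. code_eval G g x = h"
  using assms(2)
proof induction
  case one
  show ?case using code_eval_Nil by blast
next
  case (incl h)
  then obtain i where "h = g i" by auto
  moreover have "g i \<in> carrier G" using g by auto
  ultimately have "code_eval G g [Suc (2 * i)] = h" using g by (auto simp: code_eval_Cons)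
  then show ?case ..
next
  case (inv h)
  then obtain i where "h = g i" by auto
  moreover have "g i \<in> carrier G" using g by auto
  ultimately have "code_eval G g [2 * i] = inv h" using g by (auto simp: code_eval_Cons)
  then show ?case ..
next
  case (eng h1 h2)
  then obtain x y where "code_eval G g x = h1" "code_eval G g y = h2" by auto
  then have "code_eval G g (x @ y) = h1 \<otimes> h2" using g by (simp add: code_eval_append)
  then show ?case ..
qed

end

section \<open>The word problem over a given generating set\<close>

lemma word_eval_map_apfst:
  "word_eval G g (map (apfst h) w) = word_eval G (\<lambda>x. g (h x)) w"
  by (induction w) (auto simp: word_eval_def)

lemma word_eval_cong:
  assumes "\<And>l. l \<in> set w \<Longrightarrow> g (fst l) = h (fst l)"
  shows "word_eval G g w = word_eval G h w"
  using assms
proof (induction w)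
  case (Cons l w)
  have "g (fst l) = h (fst l)" using Cons.prems by simp
  then show ?case using Cons by (cases l) (simp add: word_eval_def)
qed (simp add: word_eval_def)

text \<open>An injective renaming cannot create new cancellations.\<close>

lemma free_group_map_apfst:
  assumes "w \<in> carrier (free_group X)" "inj_on f X" "f ` X \<subseteq> Y"
  shows "map (apfst f) w \<in> carrier (free_group Y)"
proof -
  have "reduced (map (apfst f) w)"
    unfolding reduced_def successively_map
  proof (rule successively_mono)
    show "successively (\<lambda>a b. \<not> opposite a b) w"
      using assms(1) by (simp add: free_group_def reduced_def)
    fix a b assume "a \<in> set w" "b \<in> set w" "\<not> opposite a b"
    moreover from this have "fst a \<in> X" "fst b \<in> X" using assms(1) by (auto simp: free_group_def)
    ultimately show "\<not> opposite (apfst f a) (apfst f b)"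
      using inj_onD[OF assms(2)] by (auto simp: opposite_def)
  qed
  moreover have "set (map (apfst f) w) \<subseteq> Y \<times> UNIV"
    using assms(1,3) by (fastforce simp: free_group_def)
  ultimately show ?thesis by (simp add: free_group_def)
qed

text \<open>The given algorithm is made total: every list is brought into the form for which an
  answer is guaranteed, without changing its value in the group.\<close>

lemma (in group) decidable_word_problemE:
  assumes "decidable_word_problem G"
  obtains g where "g \<in> UNIV \<rightarrow> carrier G" "generate G (range g) = carrier G"
    "decidable (\<lambda>e. code_eval G g (list_decode (e 0)) = \<one>)"
proof -
  obtain S e p where S: "finite_generating_set G S" and e: "bij_betw e S {..<card S}"
    and p: "\<And>w. w \<in> carrier (free_group S) \<Longrightarrow> rec_eval p [word_code (map (apfst e) w)] =
             Some (if word_eval G (\<lambda>s. s) w = \<one> then 1 else 0)"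
    using assms unfolding decidable_word_problem_def by blast
  define m where "m = card S"
  define d where "d = inv_into S e"
  have d: "bij_betw d {..<m} S" using e unfolding d_def m_def by (rule bij_betw_inv_into)
  have ed: "e (d i) = i" if "i < m" for i
    using e that unfolding d_def m_def bij_betw_def by (metis f_inv_into_f lessThan_iff)
  \<comment> \<open>The value \<open>\<one>\<close> beyond \<open>m\<close> gives every list of
    numbers a meaning in the group, and lets out-of-range letters be deleted.\<close>
  define g where "g i = (if i < m then d i else \<one>)" for i
  have SG: "S \<subseteq> carrier G" "generate G S = carrier G"
    using S by (auto simp: finite_generating_set_def)
  have g: "g \<in> UNIV \<rightarrow> carrier G" using d SG(1) unfolding g_def bij_betw_def by fastforce
  have "S \<subseteq> range g"
  proof
    fix s assume "s \<in> S"
    then obtain i where "i < m" "s = d i" using d by (auto simp: bij_betw_def)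
    then show "s \<in> range g" by (intro range_eqI[of _ _ i]) (simp add: g_def)
  qed
  then have "carrier G \<subseteq> generate G (range g)" using SG(2) mono_generate by blast
  moreover have "generate G (range g) \<subseteq> carrier G" using g by (intro generate_incl) auto
  ultimately have gen: "generate G (range g) = carrier G" by blast
  define norm where "norm x = reduce (filter (\<lambda>a. a < 2 * m) x)" for x
  have "rec_eval p [list_encode (norm x)] = Some (of_bool (code_eval G g x = \<one>))" for x
  proof -
    have "set (filter (\<lambda>a. a < 2 * m) x) \<subseteq> {..<2 * m}" by auto
    then have w: "map letter (norm x) \<in> carrier (free_group_rank m)"
      unfolding norm_def by (rule map_letter_reduce_carrier)
    then have less: "fst l < m" if "l \<in> set (map letter (norm x))" for l
      using that by (auto simp: free_group_def)
    \<comment> \<open>\<open>p\<close> is specified on words over \<open>S\<close> numbered by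
      \<open>e\<close>. Reading \<open>norm x\<close> through \<open>d\<close> gives such a word,
      and numbering it by \<open>e\<close> returns \<open>norm x\<close>.\<close>
    define w where "w = map (apfst d) (map letter (norm x))"
    have "w \<in> carrier (free_group S)"
      unfolding w_def by (rule free_group_map_apfst[OF w]) (use d in \<open>auto simp: bij_betw_def\<close>)
    moreover have "map (apfst e) w = map letter (norm x)"
    proof -
      have "map (apfst e) w = map (\<lambda>l. (e (d (fst l)), snd l)) (map letter (norm x))"
        by (simp add: w_def apfst_def map_prod_def split_beta)
      also have "\<dots> = map letter (norm x)" using less ed by (intro map_idI) auto
      finally show ?thesis .
    qed
    moreover have "word_eval G (\<lambda>s. s) w = code_eval G g x"
    proof -
      have "word_eval G (\<lambda>s. s) w = word_eval G d (map letter (norm x))"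
        unfolding w_def word_eval_map_apfst ..
      also have "\<dots> = word_eval G g (map letter (norm x))"
        using less by (intro word_eval_cong) (simp add: g_def)
      also have "\<dots> = code_eval G g (norm x)" by (simp add: code_eval_def)
      also have "\<dots> = code_eval G g x"
        unfolding norm_def code_eval_reduce[OF g] by (rule code_eval_filter[OF g]) (simp add: g_def)
      finally show ?thesis .
    qed
    ultimately have "rec_eval p [word_code (map letter (norm x))] =
        Some (if code_eval G g x = \<one> then 1 else 0)"
      using p by metis
    then show ?thesis by (simp only: word_code_letters of_bool_def)
  qed
  then have eval: "rec_eval p [list_encode (norm (list_decode (e 0)))] =
      Some (of_bool (code_eval G g (list_decode (e 0)) = \<one>))" for e :: "nat \<Rightarrow> nat"
    by blast
  have "decidable (\<lambda>e. code_eval G g (list_decode (e 0)) = \<one>)"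
    unfolding decidable_def
  proof (rule computable_partial[OF _ eval])
    show "computable (\<lambda>e. list_encode (norm (list_decode (e 0))))"
      unfolding norm_def by (intro computable_intros)
  qed
  with g gen that show thesis by blast
qed

lemma decidable_apply:
  assumes "decidable (\<lambda>e. P (list_decode (e 0)))" "computable_list F"
  shows "decidable (\<lambda>e. P (F e))"
  using computable_subst[of _ "\<lambda>_ e. list_encode (F e)", OF assms(1)[unfolded decidable_def]] assms(2)
  by (simp add: decidable_def computable_list_def)

text \<open>The first \<open>n\<close> values of an arbitrary \<open>T\<close> form one constant
  list, in which lookup is computable. In this way words chosen nonconstructively enter a
  program.\<close>

lemma computable_list_table:
  assumes "computable f"
  shows "computable_list (\<lambda>e. if f e < n then T (f e) else [])"
proof -
  have "(if i < n then T i else []) =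
      (if i < n then list_decode (hd (drop i (map (\<lambda>i. list_encode (T i)) [0..<n]))) else [])" for i
    by (simp add: hd_drop_conv_nth)
  moreover have "computable_list (\<lambda>e. if f e < n
      then list_decode (hd (drop (f e) (map (\<lambda>i. list_encode (T i)) [0..<n]))) else [])"
    by (intro computable_intros assms)
  ultimately show ?thesis by (simp only:)
qed

text \<open>Each element of the finite set \<open>S\<close> is a word \<open>T i\<close> in the
  generators \<open>h\<close> of the given algorithm. Substituting these words reduces the word
  problem over \<open>S\<close> to the one over \<open>h\<close>.\<close>

lemma (in group) word_problem_generating_set:
  assumes "decidable_word_problem G" "finite_generating_set G S"
  obtains g t where "g \<in> UNIV \<rightarrow> carrier G" "g ` {..<t} = S" "\<And>i. t \<le> i \<Longrightarrow> g i = \<one>"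
    "decidable (\<lambda>e. code_eval G g (list_decode (e 0)) = \<one>)"
proof -
  obtain h where h: "h \<in> UNIV \<rightarrow> carrier G" "generate G (range h) = carrier G"
    "decidable (\<lambda>e. code_eval G h (list_decode (e 0)) = \<one>)"
    using decidable_word_problemE[OF assms(1)] by blast
  have S: "finite S" "S \<subseteq> carrier G" using assms(2) by (auto simp: finite_generating_set_def)
  then obtain ss where ss: "set ss = S" using finite_list by blast
  define t where "t = length ss"
  define g where "g i = (if i < t then ss ! i else \<one>)" for i
  have g: "g \<in> UNIV \<rightarrow> carrier G" using S(2) ss by (auto simp: g_def t_def subset_iff)
  have img: "g ` {..<t} = S"
  proof -
    have "g ` {..<t} = (\<lambda>i. ss ! i) ` {..<t}" by (intro image_cong) (auto simp: g_def)
    then show ?thesis using ss by (auto simp: t_def set_conv_nth)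
  qed
  have "\<exists>x. code_eval G h x = g i" for i
    using generate_code_eval[OF h(1), of "g i"] h(2) g by auto
  then obtain T where T: "\<And>i. code_eval G h (T i) = g i" by metis
  define U where "U i = (if i < t then T i else [])" for i
  have U: "code_eval G h (U i) = g i" for i using T by (auto simp: U_def g_def)
  have "computable_list (\<lambda>e. subst U (list_decode (e 0)))"
  proof -
    have "computable_list (\<lambda>e. U (e 0))" unfolding U_def by (intro computable_list_table computable_intros)
    then show ?thesis by (intro computable_list_subst[where U = "\<lambda>i _. U i"] computable_intros)
  qed
  from decidable_apply[OF h(3) this]
  have "decidable (\<lambda>e. code_eval G g (list_decode (e 0)) = \<one>)"
    by (simp add: code_eval_subst[OF h(1)] U)
  moreover have "g i = \<one>" if "t \<le> i" for i using that by (simp add: g_def)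
  ultimately show thesis using that[OF g img] by blast
qed

section \<open>Lawlessness growth\<close>

(* A number v_j of the list v encodes a pair (i, a) that contributes the letter a to the i-th word,
   so that one list encodes a tuple of words and its length is their total length. *)
definition component :: "nat \<Rightarrow> nat list \<Rightarrow> nat list" where
  "component i v = map (\<lambda>c. snd (prod_decode c)) (filter (\<lambda>c. fst (prod_decode c) = i) v)"

lemma component_append: "component i (u @ v) = component i u @ component i v"
  by (simp add: component_def)

lemma computable_list_component [computable_intros]:
  assumes "computable f" "computable_list F"
  shows "computable_list (\<lambda>e. component (f e) (F e))"
proof -
  note shifted = computable_rename[OF assms(1), of Suc]
  show ?thesis unfolding component_def by (rule computable_intros shifted assms)+
qed

text \<open>Entries whose index is at least \<open>k\<close> belong to none of the components
  counted, hence only an inequality.\<close>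

lemma sum_length_component: "(\<Sum>i<k. length (component i v)) \<le> length v"
proof (induction v)
  case (Cons c v)
  have "(\<Sum>i<k. length (component i (c # v))) =
      (\<Sum>i<k. of_bool (i = fst (prod_decode c))) + (\<Sum>i<k. length (component i v))"
    unfolding sum.distrib[symmetric] by (intro sum.cong) (auto simp: component_def)
  also have "(\<Sum>i<k. of_bool (i = fst (prod_decode c))) \<le> (1 :: nat)"
    by (simp add: of_bool_def)
  finally show ?case using Cons by simp
qed (simp add: component_def)

text \<open>The tuple is packed block by block, so no length is lost. The control of the entries
  later bounds the code of \<open>v\<close>.\<close>

lemma ex_components:
  fixes J :: "nat \<Rightarrow> nat list"
  shows "\<exists>v. length v = (\<Sum>i<k. length (J i)) \<and> (\<forall>i<k. component i v = J i) \<and>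
    set v \<subseteq> {prod_encode (i, a) | i a. i < k \<and> a \<in> set (J i)}"
proof -
  define v where "v n = concat (map (\<lambda>i. map (\<lambda>a. prod_encode (i, a)) (J i)) [0..<n])" for n
  have block: "component i (map (\<lambda>a. prod_encode (j, a)) x) = (if i = j then x else [])" for i j x
    by (induction x) (auto simp: component_def)
  have "component i (v n) = (if i < n then J i else [])" for i n
    by (induction n) (auto simp: v_def component_append block, auto simp: component_def)
  moreover have "length (v n) = (\<Sum>i<n. length (J i))" for n
    by (induction n) (auto simp: v_def)
  moreover have "set (v k) \<subseteq> {prod_encode (i, a) | i a. i < k \<and> a \<in> set (J i)}"
    by (auto simp: v_def)
  ultimately show ?thesis by (intro exI[of _ "v k"]) simp
qed

lemma prod_encode_mono: "a \<le> a' \<Longrightarrow> b \<le> b' \<Longrightarrow> prod_encode (a, b) \<le> prod_encode (a', b')"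
  unfolding prod_encode_def triangle_def by (auto intro!: add_mono div_le_mono mult_le_mono)

text \<open>Pairing is monotone, so a code grows with the entries and with the length, and the
  constant list is extremal. Searching through lists of bounded length and entries thereby becomes a
  bounded quantifier over codes.\<close>

lemma list_encode_le_replicate:
  assumes "set x \<subseteq> {..b}" "length x \<le> n"
  shows "list_encode x \<le> list_encode (replicate n b)"
  using assms
proof (induction x arbitrary: n)
  case (Cons a x)
  then obtain n' where "n = Suc n'" by (cases n) auto
  then show ?case using Cons by (auto intro!: prod_encode_mono)
qed simp

lemma computable_list_replicate [computable_intros]:
  assumes "computable f"
  shows "computable_list (\<lambda>e. replicate (f e) b)"
proof -
  have "list_encode (replicate n b) = rec_nat 0 (\<lambda>_ z. Suc (prod_encode (b, z))) n" for n
    by (induction n) auto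
  moreover have "computable (\<lambda>e. rec_nat 0 (\<lambda>_ z. Suc (prod_encode (b, z))) (f e))"
    by (intro computable_intros assms)
  ultimately show ?thesis unfolding computable_list_def by (simp only:)
qed

section \<open>Complexity as a bounded search\<close>

context group
begin

context
  fixes S :: "'a set" and g :: "nat \<Rightarrow> 'a" and t :: nat
  assumes g: "g \<in> UNIV \<rightarrow> carrier G"
    and S: "g ` {..<t} = S" "generate G S = carrier G"
    and g_one: "\<And>i. t \<le> i \<Longrightarrow> g i = \<one>"
begin

text \<open>Letters of index at least \<open>t\<close> evaluate to \<open>\<one>\<close>; dropping
  them can only shorten the word.\<close>

lemma ex_word_of_code:
  "\<exists>w. set w \<subseteq> S \<times> UNIV \<and> length w \<le> length x \<and> word_eval G (\<lambda>s. s) w = code_eval G g x"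
proof (intro exI conjI)
  define y where "y = filter (\<lambda>a. a < 2 * t) x"
  show "set (map (apfst g) (map letter y)) \<subseteq> S \<times> UNIV"
    using S(1) by (auto simp: y_def letter_def)
  show "length (map (apfst g) (map letter y)) \<le> length x" by (simp add: y_def)
  show "word_eval G (\<lambda>s. s) (map (apfst g) (map letter y)) = code_eval G g x"
    unfolding word_eval_map_apfst code_eval_def[symmetric] y_def
    by (rule code_eval_filter[OF g g_one])
qed

lemma word_length_le: "word_length G S (code_eval G g x) \<le> length x"
proof -
  obtain w where w: "set w \<subseteq> S \<times> UNIV" "length w \<le> length x"
    "word_eval G (\<lambda>s. s) w = code_eval G g x"
    using ex_word_of_code by blast
  have "word_length G S (code_eval G g x) \<le> length w"
    unfolding word_length_def by (rule Least_le) (use w in blast)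
  with w(2) show ?thesis by simp
qed

lemma word_length_witness:
  assumes "h \<in> carrier G"
  obtains x where "set x \<subseteq> {..<2 * t}" "length x = word_length G S h" "code_eval G g x = h"
proof -
  have "S \<subseteq> range g" using S(1) by blast
  \<comment> \<open>\<open>word_length\<close> is a \<open>LEAST\<close>, attained once some word
    for \<open>h\<close> exists; generation by \<open>S\<close> supplies one.\<close>
  then have "h \<in> generate G (range g)" using assms S(2) mono_generate by blast
  then obtain x0 where "code_eval G g x0 = h" using generate_code_eval[OF g] by blast
  then have "\<exists>n w. set w \<subseteq> S \<times> UNIV \<and> length w = n \<and> word_eval G (\<lambda>s. s) w = h"
    using ex_word_of_code[of x0] by blast
  from LeastI_ex[OF this] obtain w where w: "set w \<subseteq> S \<times> UNIV" "length w = word_length G S h"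
    "word_eval G (\<lambda>s. s) w = h"
    unfolding word_length_def[symmetric] by blast
  \<comment> \<open>\<open>g\<close> may list an element of \<open>S\<close> several times;
    \<open>d\<close> selects one index for it.\<close>
  define d where "d = inv_into {..<t} g"
  have d: "d s < t" "g (d s) = s" if "s \<in> S" for s
    using that S(1) inv_into_into[of s g "{..<t}"] f_inv_into_f[of s g "{..<t}"]
    by (auto simp: d_def)
  define x where "x = map letter_code (map (apfst d) w)"
  have "set x \<subseteq> {..<2 * t}"
    using w(1) d(1) by (fastforce simp: x_def letter_code_def split: if_splits)
  moreover have "length x = word_length G S h" using w(2) by (simp add: x_def)
  moreover have "code_eval G g x = h"
  proof -
    have "code_eval G g x = word_eval G g (map (apfst d) w)"
      unfolding code_eval_def x_def map_letter_letter_code ..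
    also have "\<dots> = word_eval G (\<lambda>s. s) w"
      unfolding word_eval_map_apfst by (rule word_eval_cong) (use w(1) d(2) in auto)
    finally show ?thesis using w(3) by simp
  qed
  ultimately show thesis by (rule that)
qed

text \<open>From left to right, shortest words for an optimal tuple are packed into one list: at
  most \<open>N\<close> entries \<open>prod_encode (i, a)\<close> with \<open>i < k\<close> and
  \<open>a < 2 * t\<close>, which explains the bound on \<open>c\<close>. From right to left, the
  components of any list give a tuple of total word length at most the length of the list. The
  second assumption makes the minimum in \<open>complexity\<close> an attained one.\<close>

lemma complexity_le_iff:
  assumes "set r \<subseteq> {..<2 * k}"
    and "\<exists>f \<in> {..<k} \<rightarrow> carrier G. word_eval G f (map letter r) \<noteq> \<one>"
  shows "complexity G S k (map letter r) \<le> N \<longleftrightarrow>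
    (\<exists>c\<le>list_encode (replicate N (prod_encode (k, 2 * t))). length (list_decode c) \<le> N \<and>
       code_eval G g (subst (\<lambda>i. component i (list_decode c)) r) \<noteq> \<one>)"
    (is "_ \<longleftrightarrow> (\<exists>c\<le>?B. ?P c)")
proof
  assume le: "complexity G S k (map letter r) \<le> N"
  have "\<exists>n. \<exists>f \<in> {..<k} \<rightarrow> carrier G. word_eval G f (map letter r) \<noteq> \<one> \<and>
      n = (\<Sum>i<k. word_length G S (f i))"
    using assms(2) by blast
  from LeastI_ex[OF this] obtain f where f: "f \<in> {..<k} \<rightarrow> carrier G"
    "word_eval G f (map letter r) \<noteq> \<one>"
    "complexity G S k (map letter r) = (\<Sum>i<k. word_length G S (f i))"
    unfolding complexity_def[symmetric] by blast
  have "\<exists>x. set x \<subseteq> {..<2 * t} \<and> length x = word_length G S (f i) \<and> code_eval G g x = f i"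
    if "i < k" for i
    using word_length_witness[of "f i"] f(1) that by (metis Pi_mem lessThan_iff)
  then obtain J where J: "\<And>i. i < k \<Longrightarrow> set (J i) \<subseteq> {..<2 * t}"
    "\<And>i. i < k \<Longrightarrow> length (J i) = word_length G S (f i)"
    "\<And>i. i < k \<Longrightarrow> code_eval G g (J i) = f i"
    by metis
  obtain v where v: "length v = (\<Sum>i<k. length (J i))" "\<And>i. i < k \<Longrightarrow> component i v = J i"
    "set v \<subseteq> {prod_encode (i, a) | i a. i < k \<and> a \<in> set (J i)}"
    using ex_components[of J k] by blast
  have len: "length v \<le> N" using v(1) J(2) f(3) le by simp
  have "set v \<subseteq> {..prod_encode (k, 2 * t)}"
  proof
    fix c assume "c \<in> set v"
    then obtain i a where "c = prod_encode (i, a)" "i < k" "a \<in> set (J i)" using v(3) by blast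
    moreover from this have "a < 2 * t" using J(1) by blast
    ultimately show "c \<in> {..prod_encode (k, 2 * t)}" by (simp add: prod_encode_mono)
  qed
  with len have "list_encode v \<le> ?B" by (intro list_encode_le_replicate)
  moreover have "?P (list_encode v)"
  proof -
    have "code_eval G g (subst (\<lambda>i. component i v) r) = code_eval G f r"
      unfolding code_eval_subst[OF g]
    proof (rule code_eval_cong)
      fix a assume "a \<in> set r"
      then have "a div 2 < k" using assms(1) by auto
      then show "code_eval G g (component (a div 2) v) = f (a div 2)" using v(2) J(3) by simp
    qed
    then show ?thesis using f(2) len by (simp add: code_eval_def)
  qed
  ultimately show "\<exists>c\<le>?B. ?P c" by blast
next
  assume "\<exists>c\<le>?B. ?P c"
  then obtain v where v: "length v \<le> N" "code_eval G g (subst (\<lambda>i. component i v) r) \<noteq> \<one>"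
    by blast
  define f where "f i = code_eval G g (component i v)" for i
  have "f \<in> {..<k} \<rightarrow> carrier G" using g by (auto simp: f_def)
  moreover have "word_eval G f (map letter r) \<noteq> \<one>"
    using v(2) unfolding code_eval_subst[OF g] f_def[symmetric] unfolding code_eval_def .
  ultimately have "complexity G S k (map letter r) \<le> (\<Sum>i<k. word_length G S (f i))"
    unfolding complexity_def by (intro Least_le) blast
  also have "\<dots> \<le> (\<Sum>i<k. length (component i v))"
    unfolding f_def by (intro sum_mono word_length_le)
  also have "\<dots> \<le> N" using sum_length_component[of v k] v(1) by simp
  finally show "complexity G S k (map letter r) \<le> N" .
qed

end

end

theorem theorem1p8:
  fixes \<Gamma> :: "('a, 'b) monoid_scheme" and S :: "'a set" and k :: nat
  assumes "group \<Gamma>"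
    and "recursively_presented \<Gamma>"
    and "lawless \<Gamma>"
    and "decidable_word_problem \<Gamma>"
    and "finite_generating_set \<Gamma> S"
    and "k \<ge> 2"
  shows "computable_on {1..} (lawlessness_growth \<Gamma> S k)"
proof -
  interpret group \<Gamma> by (fact assms(1))
  obtain g t where g: "g \<in> UNIV \<rightarrow> carrier \<Gamma>" "g ` {..<t} = S" "\<And>i. t \<le> i \<Longrightarrow> g i = \<one>\<^bsub>\<Gamma>\<^esub>"
    and dec: "decidable (\<lambda>e. code_eval \<Gamma> g (list_decode (e 0)) = \<one>\<^bsub>\<Gamma>\<^esub>)"
    using word_problem_generating_set[OF assms(4,5)] by blast
  have gen: "generate \<Gamma> S = carrier \<Gamma>" using assms(5) by (simp add: finite_generating_set_def)
  define W where "W n = {w \<in> carrier (free_group_rank k). w \<noteq> [] \<and> length w \<le> n}" for n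
  define norm where "norm x = reduce (filter (\<lambda>a. a < 2 * k) x)" for x
  define Q where "Q r N \<longleftrightarrow> (\<exists>c\<le>list_encode (replicate N (prod_encode (k, 2 * t))).
      length (list_decode c) \<le> N \<and>
      \<not> code_eval \<Gamma> g (subst (\<lambda>i. component i (list_decode c)) r) = \<one>\<^bsub>\<Gamma>\<^esub>)" for r N
  \<comment> \<open>\<open>N\<close> comes first because \<open>computable_Least\<close> keeps the
    sought number in variable 0. The bound on \<open>c\<close> covers the codes of all reduced words
    of length at most \<open>n\<close>, whose letters have numbers below
    \<open>2 * k\<close>.\<close>
  define P where "P N n \<longleftrightarrow> (\<forall>c\<le>list_encode (replicate n (2 * k)).
      \<not> norm (list_decode c) = [] \<and> length (norm (list_decode c)) \<le> n \<longrightarrow>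
      Q (norm (list_decode c)) N)" for N n
  have Q: "Q r N \<longleftrightarrow> complexity \<Gamma> S k (map letter r) \<le> N" if "map letter r \<in> W n" for r N n
  proof -
    have w: "map letter r \<in> carrier (free_group_rank k)" "map letter r \<noteq> []"
      using that by (auto simp: W_def)
    have "set r \<subseteq> {..<2 * k}" using reduce_letter_code(2)[OF w(1)] by (simp add: comp_def)
    moreover have "\<not> law \<Gamma> k (map letter r)" using assms(3) by (auto simp: lawless_def)
    then have "\<exists>f \<in> {..<k} \<rightarrow> carrier \<Gamma>. word_eval \<Gamma> f (map letter r) \<noteq> \<one>\<^bsub>\<Gamma>\<^esub>"
      using w unfolding law_def by (simp add: free_group_def)
    ultimately show ?thesis
      unfolding Q_def using complexity_le_iff[OF g(1,2) gen g(3), of r k N] by blast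
  qed
  \<comment> \<open>One direction uses that a reduced word is its own normal form and has its code
    below the bound, the other that every normal form is a word of \<open>F_k\<close>.\<close>
  have P: "P N n \<longleftrightarrow> (\<forall>w\<in>W n. complexity \<Gamma> S k w \<le> N)" for N n
  proof
    assume P: "P N n"
    show "\<forall>w\<in>W n. complexity \<Gamma> S k w \<le> N"
    proof
      fix w assume w: "w \<in> W n"
      define x where "x = map letter_code w"
      have x: "map letter x = w" "set x \<subseteq> {..<2 * k}" "reduce x = x" "length x \<le> n" "x \<noteq> []"
        using w reduce_letter_code[of w k] unfolding x_def map_letter_letter_code
        by (auto simp: W_def)
      then have "filter (\<lambda>a. a < 2 * k) x = x" by (intro filter_True) auto
      then have "norm x = x" using x(3) by (simp add: norm_def)
      moreover have "list_encode x \<le> list_encode (replicate n (2 * k))"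
        using x(2,4) by (intro list_encode_le_replicate) auto
      ultimately have "Q x N" using P x(4,5) unfolding P_def by (metis list_encode_inverse)
      then show "complexity \<Gamma> S k w \<le> N" using Q[of x n N] x(1) w by simp
    qed
  next
    assume le: "\<forall>w\<in>W n. complexity \<Gamma> S k w \<le> N"
    have "Q (norm x) N" if "norm x \<noteq> []" "length (norm x) \<le> n" for x
    proof -
      have "map letter (norm x) \<in> carrier (free_group_rank k)"
        unfolding norm_def by (rule map_letter_reduce_carrier) auto
      then have "map letter (norm x) \<in> W n" using that by (simp add: W_def)
      then show ?thesis using Q le by blast
    qed
    then show "P N n" unfolding P_def by blast
  qed
  have fin: "finite (W n)" for n
  proof (rule finite_subset)
    show "W n \<subseteq> {w. set w \<subseteq> {..<k} \<times> UNIV \<and> length w \<le> n}" by (auto simp: W_def free_group_def)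
  qed (rule finite_lists_length_le, simp)
  have ex: "\<exists>N. P N n" for n
  proof -
    \<comment> \<open>The sum is a common upper bound for finitely many complexities.\<close>
    have "\<forall>w\<in>W n. complexity \<Gamma> S k w \<le> (\<Sum>w\<in>W n. complexity \<Gamma> S k w)"
      using fin by (auto intro: member_le_sum)
    then show ?thesis unfolding P by blast
  qed
  have norm [computable_intros]: "computable_list (\<lambda>e. norm (F e))" if "computable_list F" for F
    unfolding norm_def using that by (intro computable_intros)
  \<comment> \<open>The variables are placed as they occur under the quantifier of \<open>Q\<close>:
    0 is the code of the tuple, 1 the code of the word.\<close>
  have "computable_list (\<lambda>e. subst (\<lambda>i. component i (list_decode (e 0))) (norm (list_decode (e (Suc 0)))))"
    by (rule computable_list_subst) (intro computable_intros)+
  from decidable_apply[OF dec this]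
  have dec' [computable_intros]: "decidable (\<lambda>e. code_eval \<Gamma> g (subst (\<lambda>i. component i (list_decode (e 0)))
      (norm (list_decode (e (Suc 0))))) = \<one>\<^bsub>\<Gamma>\<^esub>)" .
  have decQ [computable_intros]: "decidable (\<lambda>e. Q (norm (list_decode (e 0))) (e (Suc 0)))"
    unfolding Q_def by (rule computable_intros)+
  have "computable (\<lambda>e. LEAST N. P N (e 0))"
  proof (rule computable_Least)
    show "decidable (\<lambda>e. P (e 0) (e (Suc 0)))" unfolding P_def by (rule computable_intros)+
  qed (rule ex)
  moreover have "(LEAST N. P N n) = lawlessness_growth \<Gamma> S k n" if "n \<in> {1..}" for n
  proof -
    \<comment> \<open>A single generator is a nontrivial word of length 1, so for \<open>n\<close>
      at least 1 the maximum is taken over a nonempty set.\<close>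
    have "reduced [(0, True)]" by (simp add: reduced_def)
    then have "[(0, True)] \<in> W n" using that assms(6) by (simp add: W_def free_group_def)
    then have "W n \<noteq> {}" by blast
    then have "(LEAST N. P N n) = Max (complexity \<Gamma> S k ` W n)"
      unfolding P using fin[of n] by (intro Least_equality) auto
    then show ?thesis by (simp add: lawlessness_growth_def W_def free_group_def)
  qed
  moreover have "computable_on {1..} (\<lambda>n. LEAST N. P N n)"
    by (rule computable_on_if_computable) fact
  ultimately show ?thesis by (simp add: computable_on_def)
qed

end
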